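(* Let $A=\{\mathbf a_1,\ldots,\mathbf a_m\}\subset\mathbb Z^n$ be a vector configuration such that $\mathbb NA$ is pointed, and let $I_A\subset K[x_1,\ldots,x_m]$ be its toric ideal. The simplicial complex $\Delta_{\mathrm{ind}(A)}$ (the indispensable complex) is a $1$-simplex if and only if $I_A$ is a principal ideal.
   Context: $K$ is a field. $\mathbb NA=\{l_1\mathbf a_1+\cdots+l_m\mathbf a_m : l_i\in\mathbb N\}$ with $0\in\mathbb N$; $\mathbb NA$ is pointed if zero is its only invertible element. The $A$-degree of $\mathbf x^{\mathbf u}=x_1^{u_1}\cdots x_m^{u_m}$ is $\deg_A(\mathbf x^{\mathbf u})=u_1\mathbf a_1+\cdots+u_m\mathbf a_m$. The toric ideal $I_A$ is the ideal generated by all binomials $\mathbf x^{\mathbf u}-\mathbf x^{\mathbf v}$ with $\deg_A(\mathbf x^{\mathbf u})=\deg_A(\mathbf x^{\mathbf v})$. $\mathcal M_A$ is the monomial ideal generated by all $\mathbf x^{\mathbf u}$ for which there exists a nonzero binomial $\mathbf x^{\mathbf u}-\mathbf x^{\mathbf v}\in I_A$, and $T_A$ is its unique minimal monomial generating set. The indispensable complex $\Delta_{\mathrm{ind}(A)}$ is the simplicial complex with vertices the elements of $T_A$ and faces all subsets of $T_A$ consisting of monomials with the same $A$-degree.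
   Formalization: The English fails if I_A = 0 (principal, but T_A is empty) or if some a_i = 0 (for A = {0}, I_A = (x_1 - 1) is principal, but the complex is a point). Here all a_i are assumed nonzero, and "principal" is read as principal and I_A ≠ 0. *)

theory Defs
  imports "HOL-Analysis.Finite_Cartesian_Product" "HOL-Library.Poly_Mapping"
begin

text \<open>
  The vectors of the configuration are indexed by a finite type \<open>'m\<close>; repetitions are allowed.
  A polynomial in the variables \<open>x\<^sub>i\<close>, \<open>i :: 'm\<close>, over \<open>'k\<close> is a finitely supported map
  from exponent vectors to coefficients.
\<close>

type_synonym ('m, 'k) mpolynomial = "('m \<Rightarrow>\<^sub>0 nat) \<Rightarrow>\<^sub>0 'k"

abbreviation mon :: "('m \<Rightarrow>\<^sub>0 nat) \<Rightarrow> ('m, 'k::field) mpolynomial" where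
  "mon u \<equiv> Poly_Mapping.single u 1"

text \<open>Ideals of a commutative ring are the submodules of the ring as a module over itself.\<close>

definition ideal_gen :: "'a::comm_ring_1 set \<Rightarrow> 'a set" where
  "ideal_gen = module.span (*)"

definition principal_ideal :: "'a::comm_ring_1 set \<Rightarrow> bool" where
  "principal_ideal I \<longleftrightarrow> (\<exists>f. I = ideal_gen {f})"

definition affine_semigroup :: "('m::finite \<Rightarrow> int ^ 'n) \<Rightarrow> (int ^ 'n) set" where
  "affine_semigroup a = {\<Sum>i\<in>UNIV. int (l i) *s a i | l :: 'm \<Rightarrow> nat. True}"

definition pointed :: "'a::ab_group_add set \<Rightarrow> bool" where
  "pointed S \<longleftrightarrow> (\<forall>x\<in>S. (\<exists>y\<in>S. x + y = 0) \<longleftrightarrow> x = 0)"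

definition A_degree :: "('m::finite \<Rightarrow> int ^ 'n) \<Rightarrow> ('m \<Rightarrow>\<^sub>0 nat) \<Rightarrow> int ^ 'n" where
  "A_degree a u = (\<Sum>i\<in>UNIV. int (Poly_Mapping.lookup u i) *s a i)"

definition toric_ideal :: "('m::finite \<Rightarrow> int ^ 'n) \<Rightarrow> ('m, 'k::field) mpolynomial set" where
  "toric_ideal a = ideal_gen {mon u - mon v | u v. A_degree a u = A_degree a v}"

definition monomial_ideal :: "('m::finite \<Rightarrow> int ^ 'n) \<Rightarrow> ('m, 'k::field) mpolynomial set" where
  "monomial_ideal a = ideal_gen
     {mon u | u. \<exists>v. mon u - mon v \<noteq> (0 :: ('m, 'k) mpolynomial) \<and>
                     mon u - mon v \<in> (toric_ideal a :: ('m, 'k) mpolynomial set)}"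

definition minimal_monomial_generators ::
    "('m, 'k::field) mpolynomial set \<Rightarrow> ('m, 'k) mpolynomial set \<Rightarrow> bool" where
  "minimal_monomial_generators I T \<longleftrightarrow>
     T \<subseteq> range mon \<and> ideal_gen T = I \<and> (\<forall>S. S \<subset> T \<longrightarrow> ideal_gen S \<noteq> I)"

text \<open>Every monomial ideal has exactly one minimal set of monomial generators, so the
  description below is proper.\<close>

definition min_gens :: "('m::finite \<Rightarrow> int ^ 'n) \<Rightarrow> ('m, 'k::field) mpolynomial set" where
  "min_gens a = (THE T. minimal_monomial_generators (monomial_ideal a) T)"

text \<open>An abstract simplicial complex is given by its set of faces, including the empty face.
  Here the vertices are the singleton faces, i.e. all elements of \<open>min_gens a\<close>.\<close>

definition indispensable_complex ::
    "('m::finite \<Rightarrow> int ^ 'n) \<Rightarrow> ('m, 'k::field) mpolynomial set set" where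
  "indispensable_complex a = {F. F \<subseteq> min_gens a \<and> (\<exists>b. F \<subseteq> mon ` {u. A_degree a u = b})}"

definition is_simplex :: "nat \<Rightarrow> 'v set set \<Rightarrow> bool" where
  "is_simplex d D \<longleftrightarrow> (\<exists>V. finite V \<and> card V = d + 1 \<and> D = Pow V)"

end

theory Submission
  imports Defs
begin

text \<open>
  Let \<open>N\<close> be the set of exponents \<open>u\<close> whose fiber under the \<open>A\<close>-degree contains another exponent.
  Then \<open>T\<^sub>A\<close> consists of the monomials of the minimal elements of \<open>N\<close>, and every polynomial in
  \<open>I\<^sub>A\<close> is supported in \<open>N\<close>.  Suppose \<open>I\<^sub>A = (f)\<close>, let \<open>u\<close> be minimal in \<open>N\<close> and \<open>v \<noteq> u\<close> of the
  same degree, and write \<open>x\<^sup>u - x\<^sup>v = f g\<close>.  As \<open>f\<close> is supported in \<open>N\<close>, the coefficient of \<open>f g\<close> at a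
  minimal \<open>w\<close> is \<open>f\<^sub>w g\<^sub>0\<close>.  Hence \<open>f\<^sub>w \<noteq> 0\<close> for all minimal \<open>w\<close>, then \<open>g\<^sub>0 \<noteq> 0\<close>, and no minimal
  element other than \<open>u\<close> and \<open>v\<close> exists; pointedness makes fibers antichains, so \<open>v\<close> is minimal.
  Conversely, if \<open>u\<close> and \<open>v\<close> are the minimal elements of \<open>N\<close> and have the same degree, a binomial
  \<open>x\<^sup>p - x\<^sup>q\<close> in \<open>I\<^sub>A\<close> is reduced modulo \<open>x\<^sup>u - x\<^sup>v\<close> to a monomial multiple of a smaller one.
\<close>

section \<open>Ideals as submodules of the ring over itself\<close>

interpretation ring_module: module "(*) :: 'a::comm_ring_1 \<Rightarrow> 'a \<Rightarrow> 'a"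
  by unfold_locales (auto simp: algebra_simps)

lemma ideal_gen_superset: "S \<subseteq> ideal_gen S"
  unfolding ideal_gen_def by (rule ring_module.span_superset)

lemma ideal_gen_mult: "x \<in> ideal_gen S \<Longrightarrow> c * x \<in> ideal_gen S"
  unfolding ideal_gen_def by (rule ring_module.span_scale)

lemma ideal_gen_add: "x \<in> ideal_gen S \<Longrightarrow> y \<in> ideal_gen S \<Longrightarrow> x + y \<in> ideal_gen S"
  unfolding ideal_gen_def by (rule ring_module.span_add)

lemma ideal_gen_sum: "(\<And>i. i \<in> A \<Longrightarrow> f i \<in> ideal_gen S) \<Longrightarrow> sum f A \<in> ideal_gen S"
  unfolding ideal_gen_def by (rule ring_module.span_sum)

lemma ideal_gen_minimal:
  assumes "S \<subseteq> J" "0 \<in> J" "\<And>x y. x \<in> J \<Longrightarrow> y \<in> J \<Longrightarrow> x + y \<in> J" "\<And>c x. x \<in> J \<Longrightarrow> c * x \<in> J"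
  shows "ideal_gen S \<subseteq> J"
  unfolding ideal_gen_def
  by (rule ring_module.span_minimal)
    (auto simp: ring_module.subspace_def assms(2-4) assms(1)[THEN subsetD])

lemma ideal_gen_subset_iff: "ideal_gen S \<subseteq> ideal_gen T \<longleftrightarrow> S \<subseteq> ideal_gen T"
  unfolding ideal_gen_def
  by (meson ring_module.span_minimal ring_module.span_superset ring_module.subspace_span subset_trans)

lemma ideal_gen_singleton: "ideal_gen {f} = range (\<lambda>g. g * f)"
  unfolding ideal_gen_def by (simp add: ring_module.span_singleton)

section \<open>Divisibility of monomials on the level of exponents\<close>

definition up_closure :: "'a::monoid_add set \<Rightarrow> 'a set" where
  "up_closure S = {s + t | s t. s \<in> S}"

text \<open>Since \<open>u = s + t\<close> encodes that x^s divides x^u, these are the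
  divisibility-minimal exponents. In the same way \<open>up_closure S\<close> is the exponent set of
  the monomial ideal generated by the x^s with s in \<open>S\<close>.\<close>

definition min_elements :: "'a::monoid_add set \<Rightarrow> 'a set" where
  "min_elements N = {u \<in> N. \<forall>s\<in>N. \<forall>t. u = s + t \<longrightarrow> s = u}"

lemma up_closure_superset: "S \<subseteq> up_closure S"
  unfolding up_closure_def by (fastforce intro: add_0_right[symmetric])

lemma up_closure_add: "u \<in> up_closure S \<Longrightarrow> u + t \<in> up_closure S"
  unfolding up_closure_def by clarify (metis add.assoc)

lemma up_closure_idem: "up_closure (up_closure S) = up_closure S"
proof
  show "up_closure (up_closure S) \<subseteq> up_closure S"
    using up_closure_add by (auto simp: up_closure_def[of "up_closure S"])
qed (rule up_closure_superset)

lemma up_closure_mono: "S \<subseteq> T \<Longrightarrow> up_closure S \<subseteq> up_closure T"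
  unfolding up_closure_def by blast

lemma min_elements_subset: "min_elements N \<subseteq> N"
  unfolding min_elements_def by blast

text \<open>A minimal \<open>u\<close> is some \<open>s + t\<close> with \<open>s\<close> in
  \<open>S\<close>, and \<open>S\<close> lies in \<open>N\<close>, so minimality forces
  \<open>s = u\<close>. This yields the uniqueness of minimal monomial generators.\<close>

lemma min_elements_subset_generators:
  assumes "up_closure S = N"
  shows "min_elements N \<subseteq> S"
proof
  fix u assume u: "u \<in> min_elements N"
  then have "u \<in> up_closure S"
    using assms min_elements_subset by blast
  then obtain s t where st: "u = s + t" "s \<in> S"
    unfolding up_closure_def by blast
  then have "s \<in> N"
    using assms up_closure_superset by blast
  then have "s = u"
    using u st(1) unfolding min_elements_def by blast
  then show "u \<in> S"
    using st(2) by simp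
qed

text \<open>The total degree. It drops on passing to a proper divisor and is the measure of both
  inductions below.\<close>

definition exponent_size :: "('m::finite \<Rightarrow>\<^sub>0 nat) \<Rightarrow> nat" where
  "exponent_size u = (\<Sum>i\<in>UNIV. Poly_Mapping.lookup u i)"

lemma exponent_size_add: "exponent_size (u + v) = exponent_size u + exponent_size v"
  by (simp add: exponent_size_def lookup_add sum.distrib)

lemma exponent_size_eq_0_iff: "exponent_size u = 0 \<longleftrightarrow> u = 0"
  by (simp add: exponent_size_def poly_mapping_eq_iff fun_eq_iff)

lemma min_element_below:
  fixes N :: "('m::finite \<Rightarrow>\<^sub>0 nat) set"
  assumes "u \<in> N"
  shows "\<exists>s\<in>min_elements N. \<exists>t. u = s + t"
  using assms
proof (induction "exponent_size u" arbitrary: u rule: less_induct)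
  case less
  show ?case
  proof (cases "u \<in> min_elements N")
    case True
    then show ?thesis by (metis add_0_right)
  next
    case False
    with less.prems obtain s t where st: "s \<in> N" "u = s + t" "s \<noteq> u"
      unfolding min_elements_def by blast
    then have "t \<noteq> 0" by auto
    then have "exponent_size s < exponent_size u"
      using st exponent_size_eq_0_iff[of t] by (simp add: exponent_size_add)
    then obtain s' t' where "s' \<in> min_elements N" "s = s' + t'"
      using less.hyps st(1) by blast
    then show ?thesis
      using st(2) by (metis add.assoc)
  qed
qed

lemma up_closure_min_elements:
  fixes N :: "('m::finite \<Rightarrow>\<^sub>0 nat) set"
  assumes "up_closure N = N"
  shows "up_closure (min_elements N) = N"
proof
  show "up_closure (min_elements N) \<subseteq> N"
    using up_closure_mono[OF min_elements_subset] assms by blast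
  show "N \<subseteq> up_closure (min_elements N)"
    using min_element_below unfolding up_closure_def by blast
qed

section \<open>Monomial ideals and their minimal generators\<close>

lemma ideal_gen_subset_supported:
  fixes G :: "('m::finite, 'k::field) mpolynomial set"
  assumes "up_closure N = N" and "\<And>f. f \<in> G \<Longrightarrow> Poly_Mapping.keys f \<subseteq> N"
  shows "ideal_gen G \<subseteq> {f. Poly_Mapping.keys f \<subseteq> N}"
proof (rule ideal_gen_minimal)
  show "c * f \<in> {f. Poly_Mapping.keys f \<subseteq> N}" if "f \<in> {f. Poly_Mapping.keys f \<subseteq> N}"
    for c f :: "('m, 'k) mpolynomial"
  proof -
    \<comment> \<open>Every exponent of \<open>c * f\<close> has a summand in the support of
      \<open>f\<close>, so an up-closed support condition survives multiplication.\<close>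
    have "b + a \<in> N" if "b \<in> Poly_Mapping.keys f" for a b
      using that \<open>f \<in> _\<close> up_closure_add[of b N] assms(1) by auto
    then show ?thesis
      using keys_mult[of c f] by (force simp: add.commute)
  qed
  show "f + g \<in> {f. Poly_Mapping.keys f \<subseteq> N}"
    if "f \<in> {f. Poly_Mapping.keys f \<subseteq> N}" "g \<in> {f. Poly_Mapping.keys f \<subseteq> N}"
    for f g :: "('m, 'k) mpolynomial"
    using that Poly_Mapping.keys_add[of f g] by blast
qed (use assms(2) in auto)

lemma sum_keys_single_lookup:
  "(\<Sum>k\<in>Poly_Mapping.keys f. Poly_Mapping.single k (Poly_Mapping.lookup f k)) = f"
  by (rule poly_mapping_eqI) (simp add: lookup_sum lookup_single when_def not_in_keys_iff_lookup_eq_zero)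

text \<open>Membership is decided term by term: a term with exponent \<open>s + t\<close> is a
  multiple of \<open>mon s\<close>.\<close>

lemma ideal_gen_monomials:
  "ideal_gen (mon ` S) = {f :: ('m::finite, 'k::field) mpolynomial. Poly_Mapping.keys f \<subseteq> up_closure S}"
proof
  show "ideal_gen (mon ` S) \<subseteq> {f :: ('m, 'k) mpolynomial. Poly_Mapping.keys f \<subseteq> up_closure S}"
    by (rule ideal_gen_subset_supported[OF up_closure_idem])
      (use up_closure_superset[of S] in auto)
  show "{f :: ('m, 'k) mpolynomial. Poly_Mapping.keys f \<subseteq> up_closure S} \<subseteq> ideal_gen (mon ` S)"
  proof clarify
    fix f :: "('m, 'k) mpolynomial"
    assume f: "Poly_Mapping.keys f \<subseteq> up_closure S"
    have "Poly_Mapping.single w (Poly_Mapping.lookup f w) \<in> ideal_gen (mon ` S)"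
      if w: "w \<in> Poly_Mapping.keys f" for w
    proof -
      obtain s t where st: "w = s + t" "s \<in> S"
        using f w unfolding up_closure_def by blast
      then have "mon s \<in> ideal_gen (mon ` S :: ('m, 'k) mpolynomial set)"
        by (intro ideal_gen_superset[THEN subsetD] imageI)
      from ideal_gen_mult[OF this, of "Poly_Mapping.single t (Poly_Mapping.lookup f w)"]
      show ?thesis
        by (simp add: st(1) mult_single add.commute)
    qed
    then have "(\<Sum>w\<in>Poly_Mapping.keys f. Poly_Mapping.single w (Poly_Mapping.lookup f w))
        \<in> ideal_gen (mon ` S)"
      by (rule ideal_gen_sum)
    then show "f \<in> ideal_gen (mon ` S)"
      by (simp add: sum_keys_single_lookup)
  qed
qed

text \<open>Testing membership on the monomials \<open>mon w\<close> recovers the up-closure from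
  the ideal, which turns questions about generators into questions about exponents.\<close>

lemma ideal_gen_monomials_eq_iff:
  "ideal_gen (mon ` S) = (ideal_gen (mon ` T) :: ('m::finite, 'k::field) mpolynomial set)
     \<longleftrightarrow> up_closure S = up_closure T"
proof
  assume eq: "ideal_gen (mon ` S) = (ideal_gen (mon ` T) :: ('m, 'k) mpolynomial set)"
  have "w \<in> up_closure S \<longleftrightarrow> w \<in> up_closure T" for w
  proof -
    have "(mon w :: ('m, 'k) mpolynomial) \<in> ideal_gen (mon ` S) \<longleftrightarrow>
          (mon w :: ('m, 'k) mpolynomial) \<in> ideal_gen (mon ` T)"
      using eq by simp
    then show ?thesis
      by (simp add: ideal_gen_monomials)
  qed
  then show "up_closure S = up_closure T" by blast
qed (simp add: ideal_gen_monomials)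

lemma inj_mon: "inj (mon :: ('m \<Rightarrow>\<^sub>0 nat) \<Rightarrow> ('m, 'k::field) mpolynomial)"
  by (rule injI) (metis keys_single singleton_inject zero_neq_one)

text \<open>The minimal elements generate, and every set of monomial generators contains them. This
  resolves the definite description in \<open>min_gens\<close>.\<close>

lemma minimal_monomial_generators_iff:
  assumes "up_closure N = N"
  shows "minimal_monomial_generators (ideal_gen (mon ` N))
           (T :: ('m::finite, 'k::field) mpolynomial set) \<longleftrightarrow> T = mon ` min_elements N"
proof
  assume T: "minimal_monomial_generators (ideal_gen (mon ` N)) T"
  then obtain S where S: "T = mon ` S"
    unfolding minimal_monomial_generators_def by (meson subset_imageE)
  have "up_closure S = N"
    using T assms unfolding minimal_monomial_generators_def S
    by (simp add: ideal_gen_monomials_eq_iff)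
  then have "mon ` min_elements N \<subseteq> T"
    unfolding S using min_elements_subset_generators by blast
  moreover have "ideal_gen (mon ` min_elements N) = (ideal_gen (mon ` N) :: ('m, 'k) mpolynomial set)"
    using assms by (simp add: ideal_gen_monomials_eq_iff up_closure_min_elements)
  ultimately show "T = mon ` min_elements N"
    using T unfolding minimal_monomial_generators_def by blast
next
  assume T: "T = mon ` min_elements N"
  have "ideal_gen S \<noteq> ideal_gen (mon ` N)" if S: "S \<subset> T" for S
  proof
    assume eq: "ideal_gen S = ideal_gen (mon ` N)"
    obtain R where R: "S = mon ` R" "R \<subseteq> min_elements N"
      using S unfolding T by (meson psubset_imp_subset subset_imageE)
    have "up_closure R = N"
      using eq assms unfolding R by (simp add: ideal_gen_monomials_eq_iff)
    then have "min_elements N \<subseteq> R"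
      by (rule min_elements_subset_generators)
    then show False
      using S R T by blast
  qed
  then show "minimal_monomial_generators (ideal_gen (mon ` N)) T"
    using assms unfolding minimal_monomial_generators_def T
    by (auto simp: ideal_gen_monomials_eq_iff up_closure_min_elements)
qed

section \<open>Fibers of the degree map and the support of the toric ideal\<close>

definition nontrivial_fibers :: "('m::finite \<Rightarrow> int ^ 'n) \<Rightarrow> ('m \<Rightarrow>\<^sub>0 nat) set" where
  "nontrivial_fibers a = {u. \<exists>v. v \<noteq> u \<and> A_degree a v = A_degree a u}"

lemma A_degree_add: "A_degree a (u + v) = A_degree a u + A_degree a v"
  by (simp add: A_degree_def lookup_add vector_sadd_rdistrib sum.distrib)

lemma A_degree_0: "A_degree a 0 = 0"
  by (simp add: A_degree_def)

text \<open>If \<open>v\<close> is a partner of \<open>u\<close> in its fiber, then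
  \<open>v + t\<close> is one of \<open>u + t\<close>; cancellation keeps them distinct.\<close>

lemma up_closure_nontrivial_fibers: "up_closure (nontrivial_fibers a) = nontrivial_fibers a"
proof
  show "up_closure (nontrivial_fibers a) \<subseteq> nontrivial_fibers a"
    unfolding up_closure_def nontrivial_fibers_def
    by clarify (metis A_degree_add add_right_cancel)
qed (rule up_closure_superset)

lemma binomial_in_toric_ideal:
  "A_degree a u = A_degree a v \<Longrightarrow>
    mon u - mon v \<in> (toric_ideal a :: ('m::finite, 'k::field) mpolynomial set)"
  unfolding toric_ideal_def by (rule ideal_gen_superset[THEN subsetD]) blast

text \<open>The two exponents of a nonzero generator are partners of each other, a trivial generator
  has empty support, and up-closedness extends this to the whole ideal.\<close>

lemma keys_toric_ideal:
  fixes f :: "('m::finite, 'k::field) mpolynomial"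
  assumes "f \<in> toric_ideal a"
  shows "Poly_Mapping.keys f \<subseteq> nontrivial_fibers a"
proof -
  have "Poly_Mapping.keys g \<subseteq> nontrivial_fibers a"
    if g: "g \<in> {mon u - mon v | u v. A_degree a u = A_degree a v}" for g :: "('m, 'k) mpolynomial"
  proof -
    obtain u v where uv: "g = mon u - mon v" "A_degree a u = A_degree a v"
      using g by blast
    show ?thesis
    proof (cases "u = v")
      case False
      then have "{u, v} \<subseteq> nontrivial_fibers a"
        using uv(2) unfolding nontrivial_fibers_def by force
      then show ?thesis
        using keys_diff[of "mon u" "mon v :: ('m, 'k) mpolynomial"] unfolding uv(1) by auto
    qed (simp add: uv(1))
  qed
  then show ?thesis
    using ideal_gen_subset_supported[OF up_closure_nontrivial_fibers] assms
    unfolding toric_ideal_def by blast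
qed

lemma monomial_ideal_eq:
  "monomial_ideal a = (ideal_gen (mon ` nontrivial_fibers a) :: ('m::finite, 'k::field) mpolynomial set)"
proof -
  have "(\<exists>v. mon u - mon v \<noteq> (0 :: ('m, 'k) mpolynomial) \<and>
             mon u - mon v \<in> (toric_ideal a :: ('m, 'k) mpolynomial set)) \<longleftrightarrow>
        u \<in> nontrivial_fibers a" (is "?L \<longleftrightarrow> ?R") for u
  proof
    assume ?L
    then obtain v where v: "mon u - mon v \<in> (toric_ideal a :: ('m, 'k) mpolynomial set)" "u \<noteq> v"
      by auto
    \<comment> \<open>It is not shown that \<open>u\<close> and \<open>v\<close> have the same
      degree; \<open>u\<close> lies in the support of an element of the toric ideal, and this
      already gives it some partner.\<close>
    then have "u \<in> Poly_Mapping.keys (mon u - mon v :: ('m, 'k) mpolynomial)"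
      by (simp add: in_keys_iff lookup_minus lookup_single)
    then show ?R
      using keys_toric_ideal[OF v(1)] by blast
  next
    assume ?R
    then obtain v where "v \<noteq> u" "A_degree a u = A_degree a v"
      unfolding nontrivial_fibers_def by force
    then show ?L
      using binomial_in_toric_ideal[of a u v] inj_mon[THEN injD, of u v] by auto
  qed
  then have "{mon u :: ('m, 'k) mpolynomial | u. \<exists>v. mon u - mon v \<noteq> (0 :: ('m, 'k) mpolynomial) \<and>
      mon u - mon v \<in> (toric_ideal a :: ('m, 'k) mpolynomial set)} = mon ` nontrivial_fibers a"
    by auto
  then show ?thesis
    unfolding monomial_ideal_def by simp
qed

lemma min_gens_eq:
  "(min_gens a :: ('m::finite, 'k::field) mpolynomial set) = mon ` min_elements (nontrivial_fibers a)"
  unfolding min_gens_def monomial_ideal_eq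
    minimal_monomial_generators_iff[OF up_closure_nontrivial_fibers] by simp

section \<open>The indispensable complex in terms of minimal exponents\<close>

lemma indispensable_complex_is_1_simplex_iff:
  "is_simplex 1 (indispensable_complex a :: ('m::finite, 'k::field) mpolynomial set set) \<longleftrightarrow>
    (\<exists>u v. u \<noteq> v \<and> A_degree a u = A_degree a v \<and> min_elements (nontrivial_fibers a) = {u, v})"
    (is "?L \<longleftrightarrow> ?R")
proof
  assume ?L
  then obtain V :: "('m, 'k) mpolynomial set"
    where V: "card V = 2" "indispensable_complex a = Pow V"
    unfolding is_simplex_def by (metis one_add_one)
  \<comment> \<open>\<open>V\<close> is itself a face, which provides the common degree
    \<open>b\<close>. Conversely each generator is a singleton face, so \<open>V\<close> contains
    all of them.\<close>
  have "V \<in> indispensable_complex a"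
    using V(2) by simp
  then obtain b where b: "V \<subseteq> min_gens a" "V \<subseteq> mon ` {u. A_degree a u = b}"
    unfolding indispensable_complex_def by blast
  have "x \<in> V" if x: "x \<in> min_gens a" for x
  proof -
    obtain u where "x = mon u"
      using x unfolding min_gens_eq by blast
    then have "{x} \<subseteq> mon ` {w. A_degree a w = A_degree a u}"
      by blast
    then have "{x} \<in> indispensable_complex a"
      using x unfolding indispensable_complex_def by blast
    then show ?thesis
      using V(2) by simp
  qed
  then have "V = mon ` min_elements (nontrivial_fibers a)"
    using b(1) unfolding min_gens_eq by blast
  moreover from this obtain u v where uv: "min_elements (nontrivial_fibers a) = {u, v}" "u \<noteq> v"
    using V(1) card_image[OF inj_on_subset[OF inj_mon subset_UNIV]] by (metis card_2_iff)
  ultimately have "mon u \<in> V" "mon v \<in> V"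
    by simp_all
  then have "A_degree a u = A_degree a v"
    using b(2) inj_mon[THEN injD] by blast
  with uv show ?R by blast
next
  assume ?R
  then obtain u v where uv: "u \<noteq> v" "A_degree a u = A_degree a v"
    "min_elements (nontrivial_fibers a) = {u, v}"
    by blast
  let ?V = "{mon u, mon v} :: ('m, 'k) mpolynomial set"
  have "?V \<subseteq> mon ` {w. A_degree a w = A_degree a u}"
    using uv(2) by auto
  then have "indispensable_complex a = Pow ?V"
    unfolding indispensable_complex_def min_gens_eq uv(3) by blast
  moreover have "card ?V = 2"
    using uv(1) inj_mon[THEN injD, of u v] by (auto simp: card_2_iff)
  ultimately show ?L
    unfolding is_simplex_def by (intro exI[of _ ?V]) auto
qed

section \<open>Pointedness and principal toric ideals\<close>

lemma pointed_A_degree_eq_0: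
  assumes "pointed (affine_semigroup a)" "\<And>i. a i \<noteq> 0" "A_degree a u = 0"
  shows "u = 0"
proof (rule ccontr)
  assume "u \<noteq> 0"
  then obtain i where i: "Poly_Mapping.lookup u i \<noteq> 0"
    by (auto simp: poly_mapping_eq_iff fun_eq_iff)
  have semigroup: "A_degree a w \<in> affine_semigroup a" for w
    unfolding A_degree_def affine_semigroup_def by blast
  have single: "A_degree a (Poly_Mapping.single i 1) = a i"
  proof -
    have "A_degree a (Poly_Mapping.single i 1) = (\<Sum>j\<in>UNIV. if i = j then a j else 0)"
      unfolding A_degree_def by (rule sum.cong) (auto simp: lookup_single when_def)
    then show ?thesis by simp
  qed
  \<comment> \<open>Splitting one x_i off x^u makes the degree of the cofactor an inverse of
    \<open>a i\<close>. The truncated subtraction is exact because x_i occurs in x^u.\<close>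
  have "u = Poly_Mapping.single i 1 + (u - Poly_Mapping.single i 1)"
    using i by (intro poly_mapping_eqI) (auto simp: lookup_add lookup_minus lookup_single when_def)
  then have "a i + A_degree a (u - Poly_Mapping.single i 1) = 0"
    using assms(3) single by (metis A_degree_add)
  then have "a i = 0"
    using assms(1) semigroup single unfolding pointed_def by metis
  then show False
    using assms(2) by blast
qed

text \<open>In the convolution over \<open>w = l + q\<close> only \<open>l\<close> in
  \<open>N\<close> contribute, and minimality of \<open>w\<close> leaves \<open>l = w\<close> and
  \<open>q = 0\<close>.\<close>

lemma lookup_mult_min_element:
  fixes f g :: "('m::finite, 'k::field) mpolynomial"
  assumes "Poly_Mapping.keys f \<subseteq> N" "w \<in> min_elements N"
  shows "Poly_Mapping.lookup (f * g) w = Poly_Mapping.lookup f w * Poly_Mapping.lookup g 0"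
proof -
  have "Poly_Mapping.lookup f l * (\<Sum>q. Poly_Mapping.lookup g q when w = l + q) =
      (Poly_Mapping.lookup f w * Poly_Mapping.lookup g 0 when l = w)" for l
  proof (cases "l = w")
    case True
    have "(\<lambda>q. Poly_Mapping.lookup g q when w = w + q) = (\<lambda>q. Poly_Mapping.lookup g q when q = 0)"
      by (auto simp: when_def)
    then show ?thesis
      using True by simp
  next
    case False
    have "Poly_Mapping.lookup f l = 0 \<or> (\<forall>q. w \<noteq> l + q)"
      using assms False unfolding min_elements_def by (auto simp: subset_iff in_keys_iff)
    then show ?thesis
      using False by auto
  qed
  then show ?thesis
    by (simp add: lookup_mult)
qed

lemma principal_toric_ideal_min_elements:
  fixes f :: "('m::finite, 'k::field) mpolynomial"
  assumes pointed: "pointed (affine_semigroup a)" "\<And>i. a i \<noteq> 0"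
    and f: "toric_ideal a = ideal_gen {f}"
    and ne: "toric_ideal a \<noteq> {0 :: ('m, 'k) mpolynomial}"
  shows "\<exists>u v. u \<noteq> v \<and> A_degree a u = A_degree a v \<and> min_elements (nontrivial_fibers a) = {u, v}"
proof -
  let ?N = "nontrivial_fibers a"
  have "0 \<in> (toric_ideal a :: ('m, 'k) mpolynomial set)"
    using f by (auto simp: ideal_gen_singleton image_iff intro: exI[of _ 0])
  with ne obtain h :: "('m, 'k) mpolynomial" where h: "h \<in> toric_ideal a" "h \<noteq> 0"
    by blast
  then have "?N \<noteq> {}"
    using keys_toric_ideal[OF h(1)] by auto
  then obtain u where u: "u \<in> min_elements ?N"
    using min_element_below by blast
  have partner: "\<exists>v. v \<noteq> w \<and> A_degree a w = A_degree a v" if "w \<in> min_elements ?N" for w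
    using that min_elements_subset unfolding nontrivial_fibers_def by force
  then obtain v where v: "v \<noteq> u" "A_degree a u = A_degree a v"
    using u by blast
  have keys_f: "Poly_Mapping.keys f \<subseteq> ?N"
    using ideal_gen_superset[of "{f}"] by (intro keys_toric_ideal) (simp add: f)
  \<comment> \<open>\<open>g0\<close> is the constant coefficient of the cofactor of
    \<open>f\<close>: it depends on the binomial but not on \<open>w\<close>.\<close>
  have factor: "\<exists>g0. \<forall>w\<in>min_elements ?N.
      Poly_Mapping.lookup (mon p - mon q) w = Poly_Mapping.lookup f w * g0"
    if "A_degree a p = A_degree a q" for p q
  proof -
    have "(mon p - mon q :: ('m, 'k) mpolynomial) \<in> range (\<lambda>g. g * f)"
      using binomial_in_toric_ideal[OF that, where 'k='k] f by (simp add: ideal_gen_singleton)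
    then obtain g where "mon p - mon q = f * g"
      by (auto simp: mult.commute)
    then show ?thesis
      using lookup_mult_min_element[OF keys_f] by auto
  qed
  \<comment> \<open>Each \<open>w\<close> is tested with a binomial of its own, whose coefficient at
    \<open>w\<close> is 1.\<close>
  have f_ne: "Poly_Mapping.lookup f w \<noteq> 0" if w: "w \<in> min_elements ?N" for w
  proof -
    obtain q where q: "q \<noteq> w" "A_degree a w = A_degree a q"
      using partner[OF w] by blast
    then have "Poly_Mapping.lookup (mon w - mon q :: ('m, 'k) mpolynomial) w = 1"
      by (simp add: lookup_minus lookup_single)
    then show ?thesis
      using factor[OF q(2)] w by auto
  qed
  obtain g0 where g0: "\<forall>w\<in>min_elements ?N.
      Poly_Mapping.lookup (mon u - mon v) w = Poly_Mapping.lookup f w * g0"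
    using factor[OF v(2)] by blast
  have "g0 \<noteq> 0"
    using g0 u v(1) by (force simp: lookup_minus lookup_single)
  \<comment> \<open>At a minimal \<open>w\<close> outside \<open>{u, v}\<close> the binomial has
    coefficient 0, while \<open>f\<close> at \<open>w\<close> and \<open>g0\<close> are both
    nonzero.\<close>
  then have sub: "min_elements ?N \<subseteq> {u, v}"
    using g0 f_ne by (force simp: lookup_minus lookup_single when_def split: if_splits)
  have "v \<in> ?N"
    using v unfolding nontrivial_fibers_def by force
  then obtain s t where st: "s \<in> min_elements ?N" "v = s + t"
    using min_element_below by blast
  \<comment> \<open>Otherwise x^u divides x^v with a cofactor of degree 0, which is 1 by
    pointedness. Hence \<open>s = v\<close>, and \<open>v\<close> is minimal.\<close>
  have "s \<noteq> u"
  proof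
    assume "s = u"
    then have "t = 0"
      using v(2) st(2) pointed_A_degree_eq_0[OF pointed] by (simp add: A_degree_add)
    then show False
      using \<open>s = u\<close> st(2) v(1) by simp
  qed
  then have "v \<in> min_elements ?N"
    using sub st(1) by blast
  then have "min_elements ?N = {u, v}"
    using u sub by auto
  then show ?thesis
    using v by (intro exI[of _ u] exI[of _ v]) auto
qed

lemma toric_ideal_eq_binomial:
  fixes a :: "'m::finite \<Rightarrow> int ^ 'n"
  assumes pointed: "pointed (affine_semigroup a)" "\<And>i. a i \<noteq> 0"
    and uv: "u \<noteq> v" "A_degree a u = A_degree a v" "min_elements (nontrivial_fibers a) = {u, v}"
  shows "toric_ideal a = (ideal_gen {mon u - mon v} :: ('m, 'k::field) mpolynomial set)"
proof
  let ?J = "ideal_gen {mon u - mon v} :: ('m, 'k) mpolynomial set"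
  show "?J \<subseteq> toric_ideal a"
    using binomial_in_toric_ideal[OF uv(2)] unfolding toric_ideal_def ideal_gen_subset_iff by blast
  have gen: "mon u - mon v \<in> ?J"
    by (rule ideal_gen_superset[THEN subsetD]) simp
  \<comment> \<open>All four cases are needed, since \<open>p\<close> and \<open>q\<close> may lie
    above the same minimal exponent or above the two in either order.\<close>
  have gen': "mon s - mon s' \<in> ?J" if "s \<in> {u, v}" "s' \<in> {u, v}" for s s'
    using that gen ideal_gen_mult[OF gen, of 0] ideal_gen_mult[OF gen, of "-1"] by auto
  \<comment> \<open>If one of the two were 0, both would have degree 0 and be equal by pointedness.
    This makes the induction below descend.\<close>
  have nonzero: "s \<noteq> 0" if "s \<in> {u, v}" for s
    using that uv(1,2) pointed_A_degree_eq_0[OF pointed] A_degree_0[of a] by (metis insertE singletonD)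
  have "mon p - mon q \<in> ?J" if "A_degree a p = A_degree a q" for p q
    using that
  proof (induction "exponent_size p" arbitrary: p q rule: less_induct)
    case less
    show ?case
    proof (cases "p = q")
      case True
      then show ?thesis
        using ideal_gen_mult[OF gen, of 0] by simp
    next
      case False
      then have "p \<in> nontrivial_fibers a" "q \<in> nontrivial_fibers a"
        using less.prems unfolding nontrivial_fibers_def by force+
      then obtain s p' s' q' where s: "s \<in> {u, v}" "p = s + p'" and s': "s' \<in> {u, v}" "q = s' + q'"
        using min_element_below[of _ "nontrivial_fibers a"] unfolding uv(3) by meson
      have "A_degree a s = A_degree a s'"
        using s(1) s'(1) uv(2) by auto
      then have "A_degree a p' = A_degree a q'"
        using less.prems s(2) s'(2) by (simp add: A_degree_add)
      moreover have "exponent_size p' < exponent_size p"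
        using nonzero[OF s(1)] exponent_size_eq_0_iff[of s] by (simp add: s(2) exponent_size_add)
      ultimately have "mon p' - mon q' \<in> ?J"
        using less.hyps by blast
      \<comment> \<open>This sum telescopes to x^p - x^q, as the mixed terms with exponent
        \<open>s' + p'\<close> cancel.\<close>
      then have "mon p' * (mon s - mon s') + mon s' * (mon p' - mon q') \<in> ?J"
        using gen'[OF s(1) s'(1)] by (intro ideal_gen_add ideal_gen_mult)
      then show ?thesis
        by (simp add: s(2) s'(2) right_diff_distrib mult_single add.commute)
    qed
  qed
  then show "toric_ideal a \<subseteq> ?J"
    unfolding toric_ideal_def ideal_gen_subset_iff by blast
qed

text \<open>The zero ideal is principal, but its complex has only the empty face, so it is excluded.
  So are zero vectors: a single zero vector gives the ideal generated by x - 1, while 1 is the only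
  vertex.\<close>

theorem proposition4p8:
  fixes a :: "'m::finite \<Rightarrow> int ^ 'n"
  assumes "pointed (affine_semigroup a)"
    and "\<And>i. a i \<noteq> 0"
  shows "is_simplex 1 (indispensable_complex a :: ('m, 'k::field) mpolynomial set set) \<longleftrightarrow>
           principal_ideal (toric_ideal a :: ('m, 'k) mpolynomial set) \<and>
           (toric_ideal a :: ('m, 'k) mpolynomial set) \<noteq> {0}"
proof
  assume "is_simplex 1 (indispensable_complex a :: ('m, 'k) mpolynomial set set)"
  then obtain u v where uv: "u \<noteq> v" "A_degree a u = A_degree a v"
    "min_elements (nontrivial_fibers a) = {u, v}"
    unfolding indispensable_complex_is_1_simplex_iff by blast
  have "principal_ideal (toric_ideal a :: ('m, 'k) mpolynomial set)"
    using toric_ideal_eq_binomial[OF assms uv] unfolding principal_ideal_def by blast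
  moreover have "mon u - mon v \<noteq> (0 :: ('m, 'k) mpolynomial)"
    using uv(1) inj_mon[THEN injD, of u v] by auto
  ultimately show "principal_ideal (toric_ideal a :: ('m, 'k) mpolynomial set) \<and>
      (toric_ideal a :: ('m, 'k) mpolynomial set) \<noteq> {0}"
    using binomial_in_toric_ideal[OF uv(2), where 'k='k] by auto
next
  assume "principal_ideal (toric_ideal a :: ('m, 'k) mpolynomial set) \<and>
      (toric_ideal a :: ('m, 'k) mpolynomial set) \<noteq> {0}"
  then show "is_simplex 1 (indispensable_complex a :: ('m, 'k) mpolynomial set set)"
    unfolding indispensable_complex_is_1_simplex_iff principal_ideal_def
    by (elim conjE exE) (rule principal_toric_ideal_min_elements[OF assms])
qed

end
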